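(* Let $a<b$ be real numbers and let $r,s$ be positive continuous functions on the interval $(a,b)$. Put $R(x,b)=\int_x^b r(t)\,dt$. Then for all measurable functions $f\ge 0$ on $(a,b)$ such that all integrals below exist and are finite, $$\int_a^b r(x)\left(\int_a^x f(t)\,dt\right)^2dx\le \sup_{a<x<b}R(x,b)\,\left(\int_a^b\frac{dx}{s(x)}\right)\int_a^b s(x)\,(f(x))^2\,dx.$$
   Context: Standing assumption: all functions are measurable and all the integrals appearing in the inequality (including those defining $R(x,b)$ and $\int_a^x f$ for $x\in(a,b)$) exist and are finite. The supremum is taken in $[0,+\infty]$, with $0\cdot\infty=0$. *)

theory Defs
  imports "HOL-Analysis.Analysis"
begin

text \<open>Real-valued; it represents the mathematical integral only where \<open>r\<close> is integrable
  on \<open>(x, b)\<close>, since the Bochner integral of a non-integrable function is \<open>0\<close>.\<close>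

definition tail_integral :: "(real \<Rightarrow> real) \<Rightarrow> real \<Rightarrow> real \<Rightarrow> real"
  where "tail_integral r x b = (LINT t:{x<..<b}|lebesgue. r t)"

end

theory Submission
  imports Defs
begin

text \<open>Cauchy--Schwarz with weight \<open>s\<close> gives
  \<open>(\<integral>\<^sub>a\<^sup>x f)\<^sup>2 \<le> (\<integral>\<^sub>a\<^sup>b 1/s) \<integral>\<^sub>a\<^sup>x s f\<^sup>2\<close>. Multiplying by \<open>r\<close>, integrating and exchanging the order of
  integration turns the right-hand side into \<open>\<integral>\<^sub>a\<^sup>b s(t) f(t)\<^sup>2 R(t,b) (\<integral>\<^sub>a\<^sup>b 1/s) dt\<close>, and the factor
  \<open>R(t,b) (\<integral>\<^sub>a\<^sup>b 1/s)\<close> is at most its supremum.\<close>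

text \<open>A countable cover by sets of finite measure stays measurable under completion and keeps
  its measures. This is what makes Tonelli available for \<open>lebesgue\<close>.\<close>

lemma sigma_finite_measure_completion:
  assumes "sigma_finite_measure M"
  shows "sigma_finite_measure (completion M)"
proof -
  obtain A where "countable A" "A \<subseteq> sets M" "\<Union>A = space M" "\<forall>a\<in>A. emeasure M a \<noteq> \<infinity>"
    using sigma_finite_measure.sigma_finite_countable[OF assms] by blast
  then show ?thesis
    by (intro sigma_finite_measure.intro exI[of _ A]) (auto intro: sets_completionI_sets)
qed

text \<open>Passes from the completed sigma-algebra on the source to the Borel one on the target, so
  that comparing two coordinates, each carrying \<open>lebesgue\<close>, is a measurable
  condition.\<close>

lemma ident_borel_measurable_lebesgue [measurable]:
  "(\<lambda>x. x) \<in> lebesgue \<rightarrow>\<^sub>M (borel :: real measure)"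
  by (rule measurable_completion) simp

text \<open>Tonelli on the triangle t < x: both iterated integrals are those of
  \<open>u x * v t\<close> times the indicator of that triangle, once the outer factor is pulled
  inside.\<close>

lemma nn_integral_swap_triangle:
  fixes u v :: "real \<Rightarrow> ennreal"
  assumes [measurable]: "u \<in> borel_measurable lebesgue" "v \<in> borel_measurable lebesgue"
  shows "(\<integral>\<^sup>+x. u x * (\<integral>\<^sup>+t. v t * indicator {..<x} t \<partial>lebesgue) \<partial>lebesgue)
    = (\<integral>\<^sup>+t. v t * (\<integral>\<^sup>+x. u x * indicator {t<..} x \<partial>lebesgue) \<partial>lebesgue)"
proof -
  interpret L: sigma_finite_measure "lebesgue :: real measure"
    by (rule sigma_finite_measure_completion) (rule sigma_finite_lborel)
  interpret P: pair_sigma_finite "lebesgue :: real measure" "lebesgue :: real measure" ..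
  have m: "(\<lambda>(x, t). u x * v t * indicator {p. snd p < fst p} (x, t))
      \<in> borel_measurable (lebesgue \<Otimes>\<^sub>M lebesgue)"
    by measurable
  have "(\<integral>\<^sup>+x. u x * (\<integral>\<^sup>+t. v t * indicator {..<x} t \<partial>lebesgue) \<partial>lebesgue)
    = (\<integral>\<^sup>+x. (\<integral>\<^sup>+t. u x * v t * indicator {p. snd p < fst p} (x, t) \<partial>lebesgue) \<partial>lebesgue)"
    by (subst nn_integral_cmult[symmetric])
       (auto intro!: nn_integral_cong simp: indicator_def mult.assoc)
  also have "\<dots> = (\<integral>\<^sup>+t. (\<integral>\<^sup>+x. u x * v t * indicator {p. snd p < fst p} (x, t) \<partial>lebesgue) \<partial>lebesgue)"
    using P.Fubini'[OF m] by simp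
  also have "\<dots> = (\<integral>\<^sup>+t. v t * (\<integral>\<^sup>+x. u x * indicator {t<..} x \<partial>lebesgue) \<partial>lebesgue)"
    by (subst nn_integral_cmult[symmetric])
       (auto intro!: nn_integral_cong simp: indicator_def ac_simps)
  finally show ?thesis .
qed

text \<open>Bridge from the Bochner integrals of the statement to \<open>nn_integral\<close>.
  Integrability excludes the default value 0 of the Bochner integral; the sign matters only on
  \<open>A\<close>, since the indicator removes the rest.\<close>

lemma ennreal_set_integral:
  assumes "set_integrable M A f" and "\<And>x. x \<in> A \<Longrightarrow> 0 \<le> f x"
  shows "ennreal (LINT x:A|M. f x) = (\<integral>\<^sup>+x. ennreal (indicator A x * f x) \<partial>M)"
  using assms unfolding set_lebesgue_integral_def set_integrable_def
  by (subst nn_integral_eq_integral) (auto simp: indicator_def)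

lemma lebesgue_measurable_indicator_mult_continuous:
  fixes g :: "real \<Rightarrow> real"
  assumes "continuous_on {a<..<b} g"
  shows "(\<lambda>x. indicator {a<..<b} x * g x) \<in> borel_measurable lebesgue"
  using borel_measurable_continuous_on_indicator[OF _ assms]
  by (intro measurable_completion) simp

theorem theorem2p5:
  fixes a b :: real and r s f :: "real \<Rightarrow> real"
  assumes "a < b"
    and "continuous_on {a<..<b} r" and "\<And>x. x \<in> {a<..<b} \<Longrightarrow> 0 < r x"
    and "continuous_on {a<..<b} s" and "\<And>x. x \<in> {a<..<b} \<Longrightarrow> 0 < s x"
    and "set_borel_measurable lebesgue {a<..<b} f"
    and "\<And>x. x \<in> {a<..<b} \<Longrightarrow> 0 \<le> f x"
    and "\<And>x. x \<in> {a<..<b} \<Longrightarrow> set_integrable lebesgue {x<..<b} r"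
    and "\<And>x. x \<in> {a<..<b} \<Longrightarrow> set_integrable lebesgue {a<..<x} f"
    and "set_integrable lebesgue {a<..<b} (\<lambda>x. r x * (LINT t:{a<..<x}|lebesgue. f t)\<^sup>2)"
    and "set_integrable lebesgue {a<..<b} (\<lambda>x. 1 / s x)"
    and "set_integrable lebesgue {a<..<b} (\<lambda>x. s x * (f x)\<^sup>2)"
  shows "ennreal (LINT x:{a<..<b}|lebesgue. r x * (LINT t:{a<..<x}|lebesgue. f t)\<^sup>2)
    \<le> (SUP x\<in>{a<..<b}. ennreal (tail_integral r x b) *
          ennreal (LINT y:{a<..<b}|lebesgue. 1 / s y))
      * ennreal (LINT x:{a<..<b}|lebesgue. s x * (f x)\<^sup>2)"
proof -
  note r_pos = assms(3) and s_pos = assms(5) and f_nonneg = assms(7)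
  let ?I = "{a<..<b}"
  define F where "F x = (LINT t:{a<..<x}|lebesgue. f t)" for x
  define S where "S = ennreal (LINT y:?I|lebesgue. 1 / s y)"
  \<comment> \<open>\<open>C\<close> may be infinite; working in \<open>ennreal\<close> covers that
    case, with 0 times infinity equal to 0.\<close>
  define C where "C = (SUP x\<in>?I. ennreal (tail_integral r x b) * S)"
  define u where "u x = ennreal (indicator ?I x * r x)" for x
  define v where "v x = ennreal (indicator ?I x * (s x * (f x)\<^sup>2))" for x
  \<comment> \<open>The Cauchy-Schwarz factors: on the interval the product of \<open>p\<close> and
    \<open>q\<close> is \<open>f\<close>, while their squares are \<open>1 / s\<close> and
    \<open>s * f^2\<close>.\<close>
  define p where "p x = ennreal (indicator ?I x * sqrt (1 / s x))" for x
  define q where "q x = ennreal (indicator ?I x * (sqrt (s x) * f x))" for x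
  have [measurable]: "u \<in> borel_measurable lebesgue"
    unfolding u_def using lebesgue_measurable_indicator_mult_continuous[OF assms(2)] by simp
  have [measurable]: "v \<in> borel_measurable lebesgue"
    using assms(12) unfolding v_def set_integrable_def
    by (auto dest: borel_measurable_integrable)
  have [measurable]: "p \<in> borel_measurable lebesgue"
    unfolding p_def using s_pos
    by (intro measurable_compose[OF lebesgue_measurable_indicator_mult_continuous measurable_ennreal]
          continuous_intros assms(4)) fastforce+
  have [measurable]: "q \<in> borel_measurable lebesgue"
  proof -
    \<comment> \<open>Measurability of \<open>f\<close> is known only after cutting off to the
      interval, so each factor gets its own indicator; the product of the two is the single
      indicator in \<open>q\<close>.\<close>
    have [measurable]: "(\<lambda>x. indicator ?I x * sqrt (s x)) \<in> borel_measurable lebesgue"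
      by (intro lebesgue_measurable_indicator_mult_continuous continuous_intros assms(4))
    have [measurable]: "(\<lambda>x. indicator ?I x * f x) \<in> borel_measurable lebesgue"
      using assms(6) by (simp add: set_borel_measurable_def)
    have "(\<lambda>x. ennreal ((indicator ?I x * sqrt (s x)) * (indicator ?I x * f x)))
        \<in> borel_measurable lebesgue"
      by measurable
    also have "(\<lambda>x. ennreal ((indicator ?I x * sqrt (s x)) * (indicator ?I x * f x))) = q"
      by (auto simp: q_def indicator_def)
    finally show ?thesis .
  qed
  have p_sq: "(\<integral>\<^sup>+t. (p t)\<^sup>2 \<partial>lebesgue) = S"
    unfolding S_def using s_pos
    by (subst ennreal_set_integral[OF assms(11)])
       (auto simp: p_def indicator_def ennreal_power less_imp_le intro!: nn_integral_cong)
  have q_sq: "(q t)\<^sup>2 = v t" for t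
    using s_pos f_nonneg
    by (auto simp: q_def v_def indicator_def ennreal_power power_mult_distrib less_imp_le)
  have F_sq: "(ennreal (F x))\<^sup>2 \<le> S * (\<integral>\<^sup>+t. v t * indicator {..<x} t \<partial>lebesgue)"
    if x: "x \<in> ?I" for x
  proof -
    have "ennreal (F x) = (\<integral>\<^sup>+t. ennreal (indicator {a<..<x} t * f t) \<partial>lebesgue)"
      unfolding F_def using x f_nonneg by (intro ennreal_set_integral assms(9)) auto
    \<comment> \<open>The cutoff at \<open>x\<close> is attached to \<open>q\<close> alone. The
      integral of \<open>p\<close> squared then runs over the whole interval and gives the constant
      \<open>S\<close>, independent of \<open>x\<close>.\<close>
    also have "\<dots> = (\<integral>\<^sup>+t. p t * (q t * indicator {..<x} t) \<partial>lebesgue)"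
    proof (intro nn_integral_cong)
      fix t
      show "ennreal (indicator {a<..<x} t * f t) = p t * (q t * indicator {..<x} t)"
        using x s_pos[of t] f_nonneg[of t]
        by (auto simp: p_def q_def indicator_def real_sqrt_divide simp flip: ennreal_mult)
    qed
    finally have "(ennreal (F x))\<^sup>2
        \<le> (\<integral>\<^sup>+t. (p t)\<^sup>2 \<partial>lebesgue) * (\<integral>\<^sup>+t. (q t * indicator {..<x} t)\<^sup>2 \<partial>lebesgue)"
      by (simp only:) (rule Cauchy_Schwarz_nn_integral; measurable)
    also have "(\<integral>\<^sup>+t. (q t * indicator {..<x} t)\<^sup>2 \<partial>lebesgue) = (\<integral>\<^sup>+t. v t * indicator {..<x} t \<partial>lebesgue)"
      by (intro nn_integral_cong) (auto simp: indicator_def q_sq)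
    finally show ?thesis by (simp add: p_sq)
  qed
  have tail: "ennreal (tail_integral r t b) = (\<integral>\<^sup>+x. u x * indicator {t<..} x \<partial>lebesgue)"
    if t: "t \<in> ?I" for t
  proof -
    have "ennreal (tail_integral r t b) = (\<integral>\<^sup>+x. ennreal (indicator {t<..<b} x * r x) \<partial>lebesgue)"
      unfolding tail_integral_def using t r_pos
      by (intro ennreal_set_integral assms(8)) (auto intro: less_imp_le)
    also have "\<dots> = (\<integral>\<^sup>+x. u x * indicator {t<..} x \<partial>lebesgue)"
      using t by (intro nn_integral_cong) (auto simp: u_def indicator_def)
    finally show ?thesis .
  qed
  have "ennreal (LINT x:?I|lebesgue. r x * (F x)\<^sup>2)
      = (\<integral>\<^sup>+x. ennreal (indicator ?I x * (r x * (F x)\<^sup>2)) \<partial>lebesgue)"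
    unfolding F_def using r_pos by (intro ennreal_set_integral assms(10)) (simp add: less_imp_le)
  also have "\<dots> \<le> (\<integral>\<^sup>+x. (S * u x) * (\<integral>\<^sup>+t. v t * indicator {..<x} t \<partial>lebesgue) \<partial>lebesgue)"
  proof (intro nn_integral_mono)
    fix x
    show "ennreal (indicator ?I x * (r x * (F x)\<^sup>2))
        \<le> (S * u x) * (\<integral>\<^sup>+t. v t * indicator {..<x} t \<partial>lebesgue)"
    proof (cases "x \<in> ?I")
      case True
      \<comment> \<open>Needed because \<open>ennreal\<close> sends negative reals to 0, so squaring
        commutes with it only for nonnegative values.\<close>
      have "0 \<le> F x"
        unfolding F_def set_lebesgue_integral_def using True f_nonneg
        by (intro integral_nonneg_AE AE_I2) (auto simp: indicator_def)
      then have "ennreal (indicator ?I x * (r x * (F x)\<^sup>2)) = u x * (ennreal (F x))\<^sup>2"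
        using True r_pos[OF True] by (simp add: u_def ennreal_mult ennreal_power)
      also have "\<dots> \<le> u x * (S * (\<integral>\<^sup>+t. v t * indicator {..<x} t \<partial>lebesgue))"
        by (intro mult_left_mono F_sq True) simp
      finally show ?thesis by (simp add: ac_simps)
    qed simp
  qed
  \<comment> \<open>The constant \<open>S\<close> travels with \<open>u\<close> through the
    exchange, so that the new inner integral is the tail integral at \<open>t\<close> times
    \<open>S\<close>, a member of the family whose supremum is \<open>C\<close>.\<close>
  also have "\<dots> = (\<integral>\<^sup>+t. v t * (\<integral>\<^sup>+x. (S * u x) * indicator {t<..} x \<partial>lebesgue) \<partial>lebesgue)"
    by (rule nn_integral_swap_triangle; measurable)
  also have "\<dots> \<le> (\<integral>\<^sup>+t. C * v t \<partial>lebesgue)"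
  proof (intro nn_integral_mono)
    fix t
    show "v t * (\<integral>\<^sup>+x. (S * u x) * indicator {t<..} x \<partial>lebesgue) \<le> C * v t"
    proof (cases "t \<in> ?I")
      case True
      have "(\<integral>\<^sup>+x. (S * u x) * indicator {t<..} x \<partial>lebesgue) = ennreal (tail_integral r t b) * S"
        unfolding tail[OF True] mult.assoc by (subst nn_integral_cmult) (simp_all add: mult.commute)
      also have "\<dots> \<le> C"
        unfolding C_def using True by (rule SUP_upper)
      finally show ?thesis by (subst mult.commute) (rule mult_right_mono; simp)
    \<comment> \<open>Outside the interval \<open>v t\<close> is 0, so no bound on the inner
      integral is required there.\<close>
    qed (simp add: v_def)
  qed
  also have "\<dots> = C * (\<integral>\<^sup>+t. v t \<partial>lebesgue)"
    by (rule nn_integral_cmult) measurable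
  also have "(\<integral>\<^sup>+t. v t \<partial>lebesgue) = ennreal (LINT x:?I|lebesgue. s x * (f x)\<^sup>2)"
    unfolding v_def using s_pos
    by (intro ennreal_set_integral[symmetric] assms(12)) (simp add: less_imp_le)
  finally show ?thesis
    unfolding F_def C_def S_def .
qed

end
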